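(* Consider the $[pqrs]$ random walk on $\mathbb{Z}$ described in the context. The expected time before absorption is $$m=\frac{1-s}{s}.$$ The expected time before absorption in $j$ when starting in $0$, $m_{0j}=s\sum_{k=0}^\infty k\,p_{0,j}^{(k)}$, is $$m_{0j}=\begin{cases}s\,\zeta_1^2\,\xi_1^{\,j}\left\{\zeta_1[r(1-r)+4pq]-j\right\}&(j\le0)\\ s\,\zeta_1^2\,\xi_2^{\,j}\left\{\zeta_1[r(1-r)+4pq]+j\right\}&(j\ge0).\end{cases}$$
   Context: The walk: let $p,q,s>0$, $r\ge0$, $p+q+r+s=1$. In each state $n\in\mathbb{Z}$, at each time step the particle moves to $n+1$ with probability $p$, moves to $n-1$ with probability $q$, stays in $n$ with probability $r$, or is absorbed in $n$ (removed) with probability $s$. Here $p_{i,j}^{(k)}$ is the probability that the particle, starting in $i$ at time $0$, has not been absorbed and is in state $j$ after $k$ steps. The time $T$ before absorption is the number of steps (forward, backward, or staying) made before the absorption; the absorption event itself is not counted as a step. Then $m=E[T]$ (independent of the starting state), and $m_{0j}=E[T\cdot 1_{\{\text{absorption occurs in } j\}}]$ when starting in $0$ (not conditioned on absorption in $j$). Notation: $$\xi_1=\frac{(1-r)+\sqrt{(1-r)^2-4pq}}{2q},\quad \xi_2=\frac{(1-r)-\sqrt{(1-r)^2-4pq}}{2q},\quad \zeta_1=\left[(1-r)^2-4pq\right]^{-1/2}.$$ *)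

theory Defs
  imports "HOL-Probability.Probability"
begin

text \<open>A state remembers where absorption took place: \<open>Absorbed n\<close> is entered only from
  \<open>Alive n\<close>, and is never left.\<close>

datatype state = Alive int | Absorbed int

instance state :: countable
  by countable_datatype

fun trans_prob :: "real \<Rightarrow> real \<Rightarrow> real \<Rightarrow> real \<Rightarrow> state \<Rightarrow> state \<Rightarrow> real" where
  "trans_prob p q r s (Alive n) (Alive m) =
     (if m = n + 1 then p else if m = n - 1 then q else if m = n then r else 0)"
| "trans_prob p q r s (Alive n) (Absorbed m) = (if m = n then s else 0)"
| "trans_prob p q r s (Absorbed n) y = (if y = Absorbed n then 1 else 0)"

text \<open>\<open>X\<close> is a realization, on the probability space \<open>M\<close>, of the Markov chain with these
  transition probabilities started in \<open>i\<close>. The last conjunct is the Markov property with the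
  conditional probabilities multiplied out, so that paths of probability 0 need no exception.\<close>

definition pqrs_walk ::
  "real \<Rightarrow> real \<Rightarrow> real \<Rightarrow> real \<Rightarrow> int \<Rightarrow> 'a measure \<Rightarrow> (nat \<Rightarrow> 'a \<Rightarrow> state) \<Rightarrow> bool" where
  "pqrs_walk p q r s i M X \<longleftrightarrow>
     prob_space M \<and>
     (\<forall>k. X k \<in> measurable M (count_space UNIV)) \<and>
     measure M {\<omega> \<in> space M. X 0 \<omega> = Alive i} = 1 \<and>
     (\<forall>k x y. measure M {\<omega> \<in> space M. (\<forall>l\<le>k. X l \<omega> = x l) \<and> X (Suc k) \<omega> = y} =
        measure M {\<omega> \<in> space M. \<forall>l\<le>k. X l \<omega> = x l} * trans_prob p q r s (x k) y)"

definition k_step_prob :: "'a measure \<Rightarrow> (nat \<Rightarrow> 'a \<Rightarrow> state) \<Rightarrow> int \<Rightarrow> nat \<Rightarrow> real" where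
  "k_step_prob M X j k = measure M {\<omega> \<in> space M. X k \<omega> = Alive j}"

text \<open>The transition from \<open>X k\<close> to \<open>X (Suc k)\<close> that absorbs the particle is not counted, so the
  number of steps made is \<open>k\<close>.\<close>

definition absorption_time :: "(nat \<Rightarrow> 'a \<Rightarrow> state) \<Rightarrow> 'a \<Rightarrow> enat" where
  "absorption_time X \<omega> =
     (if \<exists>k n. X (Suc k) \<omega> = Absorbed n
      then enat (LEAST k. \<exists>n. X (Suc k) \<omega> = Absorbed n) else \<infinity>)"

definition absorbed_in :: "'a measure \<Rightarrow> (nat \<Rightarrow> 'a \<Rightarrow> state) \<Rightarrow> int \<Rightarrow> 'a set" where
  "absorbed_in M X j = {\<omega> \<in> space M. \<exists>k. X k \<omega> = Absorbed j}"

definition expected_time :: "'a measure \<Rightarrow> (nat \<Rightarrow> 'a \<Rightarrow> state) \<Rightarrow> ennreal" where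
  "expected_time M X = (\<integral>\<^sup>+ \<omega>. ennreal_of_enat (absorption_time X \<omega>) \<partial>M)"

definition expected_time_in :: "'a measure \<Rightarrow> (nat \<Rightarrow> 'a \<Rightarrow> state) \<Rightarrow> int \<Rightarrow> ennreal" where
  "expected_time_in M X j =
     (\<integral>\<^sup>+ \<omega>. ennreal_of_enat (absorption_time X \<omega>) * indicator (absorbed_in M X j) \<omega> \<partial>M)"

definition xi1 :: "real \<Rightarrow> real \<Rightarrow> real \<Rightarrow> real" where
  "xi1 p q r = ((1 - r) + sqrt ((1 - r)^2 - 4 * p * q)) / (2 * q)"

definition xi2 :: "real \<Rightarrow> real \<Rightarrow> real \<Rightarrow> real" where
  "xi2 p q r = ((1 - r) - sqrt ((1 - r)^2 - 4 * p * q)) / (2 * q)"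

definition zeta1 :: "real \<Rightarrow> real \<Rightarrow> real \<Rightarrow> real" where
  "zeta1 p q r = ((1 - r)^2 - 4 * p * q) powr (-1/2)"

text \<open>The definition of the walk is not vacuous: drive the particle by an i.i.d. sequence, where
  \<open>Some e\<close> moves it by \<open>e\<close> and \<open>None\<close> absorbs it.\<close>

lemma pqrs_walk_exists:
  fixes p q r s :: real
  assumes "p > 0" "q > 0" "s > 0" "r \<ge> 0" "p + q + r + s = 1"
  shows "\<exists>(M :: (nat \<Rightarrow> int option) measure) X. pqrs_walk p q r s i M X"
proof -
  define L where "L = [(Some (1::int), p), (Some (-1), q), (Some 0, r), (None, s)]"
  have wf: "pmf_of_list_wf L"
    using assms by (auto simp: pmf_of_list_wf_def L_def)
  define D where "D = pmf_of_list L"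
  have pD: "measure_pmf.prob D A = sum_list (map snd (filter (\<lambda>x. fst x \<in> A) L))" for A
    unfolding D_def using measure_pmf_of_list[OF wf] .
  define upd where "upd x d = (case x of Alive n \<Rightarrow>
      (case d of Some e \<Rightarrow> Alive (n + e) | None \<Rightarrow> Absorbed n) | Absorbed n \<Rightarrow> Absorbed n)"
    for x and d :: "int option"
  have upd: "measure_pmf.prob D {d. upd x d = y} = trans_prob p q r s x y" for x y
    using assms unfolding pD by (cases x; cases y) (auto simp: upd_def L_def)
  define X where "X k \<omega> = rec_nat (Alive i) (\<lambda>n x. upd x (\<omega> n)) k" for k and \<omega> :: "nat \<Rightarrow> int option"
  have X0: "X 0 \<omega> = Alive i" and XS: "X (Suc k) \<omega> = upd (X k \<omega>) (\<omega> k)" for k \<omega>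
    by (simp_all add: X_def)
  define M where "M = PiM (UNIV :: nat set) (\<lambda>_. measure_pmf D)"
  interpret prob_space M
    unfolding M_def by (intro prob_space_PiM measure_pmf.prob_space_axioms)
  have meas: "X k \<in> measurable (PiM I (\<lambda>_. measure_pmf D)) (count_space UNIV)"
    if "{..<k} \<subseteq> I" for k I
    using that
  proof (induction k)
    case 0
    show ?case unfolding X0 by simp
  next
    case (Suc k)
    have 1: "X k \<in> measurable (PiM I (\<lambda>_. measure_pmf D)) (count_space UNIV)"
      using Suc by (simp add: lessThan_Suc)
    have "(\<lambda>\<omega>. \<omega> k) \<in> measurable (PiM I (\<lambda>_. measure_pmf D)) (measure_pmf D)"
      using Suc.prems by (intro measurable_component_singleton) auto
    then have "(\<lambda>\<omega>. upd x (\<omega> k)) \<in> measurable (PiM I (\<lambda>_. measure_pmf D)) (count_space UNIV)" for x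
      by (rule measurable_compose) simp
    from measurable_compose_countable[OF this 1]
    show ?case by (simp add: XS[abs_def])
  qed
  have X_restrict: "X l (restrict \<omega> {..<k}) = X l \<omega>" if "l \<le> k" for l k \<omega>
    using that by (induction l) (simp_all add: X0 XS)
  have comp: "distr M (measure_pmf D) (\<lambda>\<omega>. \<omega> k) = measure_pmf D" for k
    unfolding M_def by (rule distr_PiM_component) (simp_all add: measure_pmf.prob_space_axioms)
  have meas_k: "(\<lambda>\<omega>. \<omega> k) \<in> measurable M (measure_pmf D)" for k
    unfolding M_def by (rule measurable_component_singleton) simp
  have "distr M (PiM UNIV (\<lambda>_. measure_pmf D)) (\<lambda>\<omega>. restrict (\<lambda>l. \<omega> l) UNIV) =
      PiM UNIV (\<lambda>l. distr M (measure_pmf D) (\<lambda>\<omega>. \<omega> l))"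
    unfolding comp M_def[symmetric] by (simp add: restrict_UNIV)
  then have ind: "indep_vars (\<lambda>_. measure_pmf D) (\<lambda>l \<omega>. \<omega> l) (UNIV :: nat set)"
    by (subst indep_vars_iff_distr_eq_PiM) (use meas_k in simp_all)
  have markov: "measure M {\<omega> \<in> space M. (\<forall>l\<le>k. X l \<omega> = x l) \<and> X (Suc k) \<omega> = y} =
      measure M {\<omega> \<in> space M. \<forall>l\<le>k. X l \<omega> = x l} * trans_prob p q r s (x k) y" for k x y
  proof -
    let ?A = "{..<k}" and ?B = "{k}"
    let ?NA = "PiM ?A (\<lambda>_. measure_pmf D)" and ?NB = "PiM ?B (\<lambda>_. measure_pmf D)"
    define U where "U = {\<omega> \<in> space ?NA. \<forall>l\<le>k. X l \<omega> = x l}"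
    define V where "V = {\<omega> \<in> space ?NB. upd (x k) (\<omega> k) = y}"
    have U: "U \<in> sets ?NA"
    proof -
      have "{\<omega> \<in> space ?NA. X l \<omega> = x l} \<in> sets ?NA" if "l \<le> k" for l
      proof -
        have "X l -` {x l} \<inter> space ?NA \<in> sets ?NA"
          using that by (intro measurable_sets[OF meas]) auto
        then show ?thesis by (simp add: vimage_def Int_def conj_commute)
      qed
      then show ?thesis unfolding U_def
        using sets.sets_Collect_finite_All[of "{..k}" ?NA "\<lambda>l \<omega>. X l \<omega> = x l"] by simp
    qed
    have V: "V \<in> sets ?NB"
    proof -
      have "(\<lambda>\<omega>. \<omega> k) \<in> measurable ?NB (measure_pmf D)"
        by (intro measurable_component_singleton) auto
      then have "(\<lambda>\<omega>. \<omega> k) -` {d. upd (x k) d = y} \<inter> space ?NB \<in> sets ?NB"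
        by (rule measurable_sets) simp
      then show ?thesis unfolding V_def by (simp add: vimage_def Int_def conj_commute)
    qed
    have "indep_var ?NA (\<lambda>\<omega>. restrict (\<lambda>l. \<omega> l) ?A) ?NB (\<lambda>\<omega>. restrict (\<lambda>l. \<omega> l) ?B)"
      by (rule indep_var_restrict[OF ind]) auto
    from indep_varD[OF this U V]
    have "prob ((\<lambda>\<omega>. (restrict \<omega> ?A, restrict \<omega> ?B)) -` (U \<times> V) \<inter> space M) =
        prob ((\<lambda>\<omega>. restrict \<omega> ?A) -` U \<inter> space M) * prob ((\<lambda>\<omega>. restrict \<omega> ?B) -` V \<inter> space M)" .
    moreover have "(\<lambda>\<omega>. restrict \<omega> ?A) -` U \<inter> space M = {\<omega> \<in> space M. \<forall>l\<le>k. X l \<omega> = x l}"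
      by (auto simp: U_def X_restrict space_PiM)
    moreover have "(\<lambda>\<omega>. (restrict \<omega> ?A, restrict \<omega> ?B)) -` (U \<times> V) \<inter> space M =
        {\<omega> \<in> space M. (\<forall>l\<le>k. X l \<omega> = x l) \<and> X (Suc k) \<omega> = y}"
      by (auto simp: U_def V_def X_restrict XS space_PiM)
    moreover have "prob ((\<lambda>\<omega>. restrict \<omega> ?B) -` V \<inter> space M) = trans_prob p q r s (x k) y"
    proof -
      have "(\<lambda>\<omega>. restrict \<omega> ?B) -` V \<inter> space M = (\<lambda>\<omega>. \<omega> k) -` {d. upd (x k) d = y} \<inter> space M"
        by (auto simp: V_def space_PiM)
      also have "prob \<dots> = measure (distr M (measure_pmf D) (\<lambda>\<omega>. \<omega> k)) {d. upd (x k) d = y}"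
        using meas_k by (simp add: measure_distr)
      also have "\<dots> = trans_prob p q r s (x k) y"
        unfolding comp by (rule upd)
      finally show ?thesis .
    qed
    ultimately show ?thesis by simp
  qed
  have "pqrs_walk p q r s i M X"
    unfolding pqrs_walk_def
    using markov meas[of _ UNIV] prob_space_axioms prob_space
    by (simp add: X0 M_def)
  then show ?thesis by blast
qed

end

theory Submission
  imports Defs
begin

text \<open>
  Almost every path makes only transitions of positive probability. On such a path the time \<open>T\<close>
  before absorption is the number of \<open>k\<close> with \<open>X (Suc k)\<close> alive. Survival of each step has probability
  \<open>1 - s\<close> independently of the position, so \<open>E[T]\<close> is the sum of \<open>(1 - s)^(k + 1)\<close> over \<open>k\<close>, which is
  \<open>(1 - s) / s\<close>. Likewise \<open>T\<close> restricted to absorption in \<open>j\<close> is the sum over \<open>k\<close> of \<open>k\<close> times the indicator of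
  \<open>X k = Alive j \<and> X (Suc k) = Absorbed j\<close>, an event of probability \<open>s p\<^sub>0\<^sub>j\<^sup>(\<^sup>k\<^sup>)\<close>
  by the Markov property. This reduces the second claim to a closed form for \<open>\<Sum>k. k p\<^sub>0\<^sub>j\<^sup>(\<^sup>k\<^sup>)\<close>.

  Let \<open>L\<close> be the operator that evolves the surviving mass by one step, so that the \<open>k\<close>-step
  probabilities are \<open>L\<^sup>k \<delta>\<^sub>0\<close>, where \<open>\<delta>\<^sub>0\<close> is the point mass at 0. Summing the recursion over \<open>k\<close> shows
  that \<open>g = \<Sum>k. L\<^sup>k \<delta>\<^sub>0\<close> and \<open>u = \<Sum>k. k L\<^sup>k \<delta>\<^sub>0\<close> satisfy \<open>g = L g + \<delta>\<^sub>0\<close> and \<open>u = L u + (g - \<delta>\<^sub>0)\<close>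
  (lemmas \<open>green_eq\<close> and \<open>moment_eq\<close>). Both are bounded, because \<open>L\<close> contracts the supremum norm by
  \<open>1 - s\<close>, and for the same reason a bounded solution of either equation is unique
  (\<open>bounded_solution_unique\<close>). So no generating function has to be computed or differentiated: it
  suffices to check that the closed forms are bounded and solve the equations.

  They are built from the roots \<open>\<xi>\<^sub>1 > 1 > \<xi>\<^sub>2 > 0\<close> of the characteristic equation
  \<open>q x\<^sup>2 - (1 - r) x + p = 0\<close>. The solutions decaying to the left and to the right, \<open>\<xi>\<^sub>1\<^sup>j\<close> and
  \<open>\<xi>\<^sub>2\<^sup>j\<close>, glue at 0 to \<open>g = \<zeta> \<xi>\<^sup>j\<close>. The source \<open>g\<close> resonates with these exponentials, which is why \<open>u\<close> carries a
  factor linear in \<open>j\<close> (\<open>evolve_two_sided\<close>).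
\<close>

section \<open>Evolution of the surviving mass\<close>

text \<open>Exponential decay beats linear growth; this bounds either half of the closed forms.\<close>

lemma times_power_bounded:
  fixes x :: real
  assumes "0 < x" "x < 1"
  shows "\<exists>B. \<forall>n. \<bar>x ^ n * (a + b * real n)\<bar> \<le> B"
proof -
  have "(\<lambda>n. a * x ^ n + b * (real n * x ^ n)) \<longlonglongrightarrow> a * 0 + b * 0"
    using assms
    by (intro tendsto_add tendsto_mult tendsto_const LIMSEQ_realpow_zero powser_times_n_limit_0) auto
  then have "Bseq (\<lambda>n. a * x ^ n + b * (real n * x ^ n))"
    by (intro convergent_imp_Bseq convergentI)
  then show ?thesis
    by (auto simp: Bseq_def algebra_simps)
qed

locale pqrs_parameters =
  fixes p q r s :: real
  assumes p_pos: "p > 0" and q_pos: "q > 0" and s_pos: "s > 0" and r_nonneg: "r \<ge> 0"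
    and total: "p + q + r + s = 1"
begin

text \<open>The effect of one time step on the distribution of the surviving particle. The coefficients are
  nonnegative with sum \<open>1 - s\<close>, which makes it a strict contraction in the supremum norm.\<close>

definition evolve :: "(int \<Rightarrow> real) \<Rightarrow> int \<Rightarrow> real" where
  "evolve f j = p * f (j - 1) + q * f (j + 1) + r * f j"

lemma evolve_diff: "evolve (\<lambda>j. f j - g j) j = evolve f j - evolve g j"
  by (simp add: evolve_def algebra_simps)

lemma abs_evolve_le:
  assumes "\<And>j. \<bar>f j\<bar> \<le> B"
  shows "\<bar>evolve f j\<bar> \<le> (1 - s) * B"
proof -
  have "\<bar>evolve f j\<bar> \<le> p * \<bar>f (j - 1)\<bar> + q * \<bar>f (j + 1)\<bar> + r * \<bar>f j\<bar>"
    unfolding evolve_def using p_pos q_pos r_nonneg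
    by (intro order.trans[OF abs_triangle_ineq] add_mono) (simp_all add: abs_mult)
  also have "\<dots> \<le> p * B + q * B + r * B"
    using p_pos q_pos r_nonneg assms by (intro add_mono mult_left_mono) simp_all
  also have "\<dots> = (p + q + r) * B"
    by (simp add: algebra_simps)
  also have "p + q + r = 1 - s" using total by simp
  finally show ?thesis .
qed

text \<open>Iterating a strict contraction on a bounded fixed point shrinks it to nothing.\<close>

lemma bounded_fixpoint_of_evolve_is_zero:
  assumes bound: "\<And>j. \<bar>h j\<bar> \<le> B" and fixpoint: "\<And>j. h j = evolve h j"
  shows "h j = 0"
proof -
  have "\<bar>h j\<bar> \<le> (1 - s) ^ n * B" for n j
  proof (induction n arbitrary: j)
    case 0
    show ?case using bound by simp
  next
    case (Suc n)
    then show ?case using abs_evolve_le[of h "(1 - s) ^ n * B" j] fixpoint[of j]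
      by (simp add: mult.assoc)
  qed
  moreover have "(\<lambda>n. (1 - s) ^ n * B) \<longlonglongrightarrow> 0 * B"
    using s_pos p_pos q_pos r_nonneg total
    by (intro tendsto_mult_right LIMSEQ_realpow_zero) simp_all
  ultimately have "\<bar>h j\<bar> \<le> 0"
    by (intro LIMSEQ_le_const[of "\<lambda>n. (1 - s) ^ n * B"]) auto
  then show ?thesis by simp
qed

section \<open>The characteristic roots\<close>

abbreviation "\<xi>\<^sub>1 \<equiv> xi1 p q r"
abbreviation "\<xi>\<^sub>2 \<equiv> xi2 p q r"
abbreviation "\<zeta> \<equiv> zeta1 p q r"

text \<open>The gap \<open>q (\<xi>\<^sub>1 - \<xi>\<^sub>2)\<close> between the characteristic roots, and the reciprocal of \<open>\<zeta>\<close>. Working with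
  it avoids the real power in the definition of \<open>\<zeta>\<close>.\<close>

definition \<delta> :: real where "\<delta> = sqrt ((1 - r)^2 - 4 * p * q)"

text \<open>The term \<open>4 q s\<close> is positive because absorption has positive probability; it separates the
  characteristic roots from each other and from 1.\<close>

lemma discriminant_eq: "(1 - r)^2 - 4 * p * q = (p + s - q)^2 + 4 * q * s"
proof -
  have sum: "1 - r = p + q + s" using total by simp
  show ?thesis unfolding sum by (simp add: power2_eq_square algebra_simps)
qed

lemma discriminant_pos: "(1 - r)^2 - 4 * p * q > 0"
  unfolding discriminant_eq using q_pos s_pos by (intro add_nonneg_pos) simp_all

lemma \<delta>_pos: "\<delta> > 0"
  and \<delta>_square: "\<delta>^2 = (1 - r)^2 - 4 * p * q"
  and \<zeta>_eq: "\<zeta> = 1 / \<delta>"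
proof -
  show "\<delta> > 0" unfolding \<delta>_def using discriminant_pos by (rule real_sqrt_gt_zero)
  show "\<delta>^2 = (1 - r)^2 - 4 * p * q" unfolding \<delta>_def
    using discriminant_pos by (intro real_sqrt_pow2 less_imp_le)
  have "\<zeta> = ((1 - r)^2 - 4 * p * q) powr - (1 / 2)" by (simp add: zeta1_def)
  also have "\<dots> = 1 / \<delta>"
    unfolding powr_minus \<delta>_def
    using powr_half_sqrt[OF less_imp_le[OF discriminant_pos]] by (simp only: inverse_eq_divide)
  finally show "\<zeta> = 1 / \<delta>" .
qed

lemma abs_less_\<delta>: "\<bar>p + s - q\<bar> < \<delta>"
  unfolding \<delta>_def discriminant_eq
  using q_pos s_pos by (intro real_less_rsqrt) simp

lemma \<delta>_less_1_minus_r: "\<delta> < 1 - r"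
  unfolding \<delta>_def using p_pos q_pos r_nonneg s_pos total
  by (intro real_less_lsqrt) (simp_all add: discriminant_pos)

lemma \<xi>\<^sub>1_eq: "\<xi>\<^sub>1 = ((1 - r) + \<delta>) / (2 * q)" and \<xi>\<^sub>2_eq: "\<xi>\<^sub>2 = ((1 - r) - \<delta>) / (2 * q)"
  by (simp_all add: xi1_def xi2_def \<delta>_def)

lemma \<xi>\<^sub>1_gt_1: "\<xi>\<^sub>1 > 1" and \<xi>\<^sub>2_pos: "\<xi>\<^sub>2 > 0" and \<xi>\<^sub>2_lt_1: "\<xi>\<^sub>2 < 1"
proof -
  have "2 * q < (1 - r) + \<delta>" "0 < (1 - r) - \<delta>" "(1 - r) - \<delta> < 2 * q"
    using abs_less_\<delta> \<delta>_less_1_minus_r total by linarith+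
  then show "\<xi>\<^sub>1 > 1" "\<xi>\<^sub>2 > 0" "\<xi>\<^sub>2 < 1"
    unfolding \<xi>\<^sub>1_eq \<xi>\<^sub>2_eq using q_pos by simp_all
qed

lemma q_\<xi>\<^sub>1: "q * \<xi>\<^sub>1 = ((1 - r) + \<delta>) / 2" and q_\<xi>\<^sub>2: "q * \<xi>\<^sub>2 = ((1 - r) - \<delta>) / 2"
  using q_pos by (simp_all add: \<xi>\<^sub>1_eq \<xi>\<^sub>2_eq)

lemma \<xi>_product: "q * \<xi>\<^sub>1 * \<xi>\<^sub>2 = p"
proof -
  have "4 * q * (q * \<xi>\<^sub>1 * \<xi>\<^sub>2) = (2 * (q * \<xi>\<^sub>1)) * (2 * (q * \<xi>\<^sub>2))"
    by simp
  also have "\<dots> = (1 - r)^2 - \<delta>^2"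
    unfolding q_\<xi>\<^sub>1 q_\<xi>\<^sub>2 by (simp add: power2_eq_square field_simps)
  also have "\<dots> = 4 * q * p"
    unfolding \<delta>_square by simp
  finally show ?thesis using q_pos by simp
qed

lemma p_div_\<xi>\<^sub>1: "p / \<xi>\<^sub>1 = q * \<xi>\<^sub>2" and p_div_\<xi>\<^sub>2: "p / \<xi>\<^sub>2 = q * \<xi>\<^sub>1"
proof -
  have "\<xi>\<^sub>1 \<noteq> 0" "\<xi>\<^sub>2 \<noteq> 0" using \<xi>\<^sub>1_gt_1 \<xi>\<^sub>2_pos by linarith+
  moreover have "q * y = x / z" if "q * z * y = x" "z \<noteq> 0" for x y z :: real
    using that by (simp add: eq_divide_eq mult_ac)
  ultimately show "p / \<xi>\<^sub>1 = q * \<xi>\<^sub>2" "p / \<xi>\<^sub>2 = q * \<xi>\<^sub>1"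
    using \<xi>_product mult.assoc mult.commute by metis+
qed

text \<open>The condition on \<open>x\<close> is the characteristic equation \<open>q x\<^sup>2 - (1 - r) x + p = 0\<close>, so the exponential
  itself is invariant, and a linear factor leaves behind only a multiple of its slope.\<close>

lemma evolve_exponential:
  assumes "x \<noteq> 0" and "p / x + q * x = 1 - r"
  shows "evolve (\<lambda>j. x powi j * (a + b * of_int j)) j =
           x powi j * (a + b * of_int j) + b * x powi j * (q * x - p / x)"
proof -
  have "evolve (\<lambda>j. x powi j * (a + b * of_int j)) j =
      x powi j * ((p / x + q * x + r) * (a + b * of_int j) + b * (q * x - p / x))"
    using assms(1)
    by (simp add: evolve_def power_int_add power_int_diff field_simps)
  also have "p / x + q * x + r = 1" using assms(2) by simp
  finally show ?thesis by (simp add: algebra_simps)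
qed

lemma evolve_\<xi>\<^sub>1:
  "evolve (\<lambda>j. \<xi>\<^sub>1 powi j * (a + b * of_int j)) j = \<xi>\<^sub>1 powi j * (a + b * of_int j) + b * \<xi>\<^sub>1 powi j * \<delta>"
  using evolve_exponential[of "\<xi>\<^sub>1" a b j] \<xi>\<^sub>1_gt_1 unfolding p_div_\<xi>\<^sub>1 q_\<xi>\<^sub>1 q_\<xi>\<^sub>2
  by (simp add: field_simps)

lemma evolve_\<xi>\<^sub>2:
  "evolve (\<lambda>j. \<xi>\<^sub>2 powi j * (a + b * of_int j)) j = \<xi>\<^sub>2 powi j * (a + b * of_int j) - b * \<xi>\<^sub>2 powi j * \<delta>"
  using evolve_exponential[of "\<xi>\<^sub>2" a b j] \<xi>\<^sub>2_pos unfolding p_div_\<xi>\<^sub>2 q_\<xi>\<^sub>1 q_\<xi>\<^sub>2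
  by (simp add: field_simps)

section \<open>Two-sided exponential profiles\<close>

text \<open>On either side of the origin \<open>two_sided a b\<close> takes the characteristic root that decays there, with
  the linear factor \<open>a + b \<bar>j\<bar>\<close>. Both quantities computed below have this form.\<close>

definition two_sided :: "real \<Rightarrow> real \<Rightarrow> int \<Rightarrow> real" where
  "two_sided a b j =
     (if j \<le> 0 then \<xi>\<^sub>1 powi j * (a - b * of_int j) else \<xi>\<^sub>2 powi j * (a + b * of_int j))"

lemma two_sided_nonneg: "j \<ge> 0 \<Longrightarrow> two_sided a b j = \<xi>\<^sub>2 powi j * (a + b * of_int j)"
  by (auto simp: two_sided_def)

text \<open>Away from the origin only the slope of the linear factor contributes, which is
  again a two-sided profile. At the origin the two branches meet, and the kink produces a point
  source. Matching these two terms to a given equation fixes \<open>a\<close> and \<open>b\<close>.\<close>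

lemma evolve_two_sided:
  "evolve (two_sided a b) j =
     two_sided a b j - two_sided (b * \<delta>) 0 j - (if j = 0 then \<delta> * a - (1 - r) * b else 0)"
proof -
  consider "j < 0" | "j > 0" | "j = 0" by linarith
  then show ?thesis
  proof cases
    case 1
    then have "evolve (two_sided a b) j = evolve (\<lambda>j. \<xi>\<^sub>1 powi j * (a + (- b) * of_int j)) j"
      by (simp add: evolve_def two_sided_def)
    then show ?thesis using 1 unfolding evolve_\<xi>\<^sub>1 by (simp add: two_sided_def)
  next
    case 2
    then have "evolve (two_sided a b) j = evolve (\<lambda>j. \<xi>\<^sub>2 powi j * (a + b * of_int j)) j"
      by (simp add: evolve_def two_sided_nonneg)
    then show ?thesis using 2 unfolding evolve_\<xi>\<^sub>2 by (simp add: two_sided_def)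
  next
    case 3
    have "evolve (two_sided a b) 0 = (p / \<xi>\<^sub>1 + q * \<xi>\<^sub>2) * (a + b) + r * a"
      by (simp add: evolve_def two_sided_def power_int_minus algebra_simps divide_inverse)
    also have "\<dots> = (1 - r - \<delta>) * (a + b) + r * a"
      by (simp add: p_div_\<xi>\<^sub>1 q_\<xi>\<^sub>2)
    finally show ?thesis using 3 by (simp add: two_sided_def algebra_simps)
  qed
qed

lemma two_sided_bounded: "\<exists>B. \<forall>j. \<bar>two_sided a b j\<bar> \<le> B"
proof -
  obtain B1 where B1: "\<And>n. \<bar>inverse \<xi>\<^sub>1 ^ n * (a + b * real n)\<bar> \<le> B1"
    using times_power_bounded[of "inverse \<xi>\<^sub>1" a b] \<xi>\<^sub>1_gt_1 by (auto simp: inverse_less_1_iff)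
  obtain B2 where B2: "\<And>n. \<bar>\<xi>\<^sub>2 ^ n * (a + b * real n)\<bar> \<le> B2"
    using times_power_bounded[of "\<xi>\<^sub>2" a b] \<xi>\<^sub>2_pos \<xi>\<^sub>2_lt_1 by auto
  have "\<bar>two_sided a b j\<bar> \<le> max B1 B2" for j
  proof (cases "j \<le> 0")
    case True
    then have "two_sided a b j = inverse \<xi>\<^sub>1 ^ nat (- j) * (a + b * real (nat (- j)))"
      by (auto simp: two_sided_def power_int_def power_inverse)
    then show ?thesis using B1[of "nat (- j)"] by simp
  next
    case False
    then have "two_sided a b j = \<xi>\<^sub>2 ^ nat j * (a + b * real (nat j))"
      by (auto simp: two_sided_def power_int_def)
    then show ?thesis using B2[of "nat j"] by simp
  qed
  then show ?thesis by blast
qed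

text \<open>This turns the summation of a series into a verification: a quantity that is known to be bounded
  equals a guessed two-sided profile as soon as both satisfy the same inhomogeneous equation.\<close>

lemma bounded_solution_unique:
  assumes "\<And>j. \<bar>f j\<bar> \<le> B" and "\<And>j. f j = evolve f j + c j"
    and "\<And>j. two_sided a b j = evolve (two_sided a b) j + c j"
  shows "f j = two_sided a b j"
proof -
  obtain B' where B': "\<And>j. \<bar>two_sided a b j\<bar> \<le> B'"
    using two_sided_bounded by blast
  have "f j - two_sided a b j = 0"
  proof (rule bounded_fixpoint_of_evolve_is_zero[where B = "B + B'"])
    show "\<bar>f j - two_sided a b j\<bar> \<le> B + B'" for j
      using assms(1)[of j] B'[of j] by linarith
    show "f j - two_sided a b j = evolve (\<lambda>j. f j - two_sided a b j) j" for j
      unfolding evolve_diff using assms(2,3)[of j] by linarith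
  qed
  then show ?thesis by simp
qed

section \<open>Visit counts and their first moments\<close>

text \<open>The \<open>k\<close>-step probabilities of the walk, as determined by the recursion alone.\<close>

primrec occupation :: "nat \<Rightarrow> int \<Rightarrow> real" where
  "occupation 0 = (\<lambda>j. of_bool (j = 0))"
| "occupation (Suc k) = evolve (occupation k)"

lemma occupation_nonneg: "occupation k j \<ge> 0"
  using p_pos q_pos r_nonneg by (induction k arbitrary: j) (auto simp: evolve_def)

lemma occupation_le: "occupation k j \<le> (1 - s) ^ k"
proof -
  have "\<bar>occupation k j\<bar> \<le> (1 - s) ^ k"
    by (induction k arbitrary: j) (auto intro: abs_evolve_le)
  then show ?thesis by simp
qed

lemma summable_geometric_moment: "summable (\<lambda>k. real k * (1 - s) ^ k)"
proof -
  have "norm (1 - s) < 1" using s_pos p_pos q_pos r_nonneg total by simp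
  from geometric_deriv_sums[OF this]
  have "summable (\<lambda>n. of_nat (Suc n) * (1 - s) ^ n)" by (rule sums_summable)
  then have "summable (\<lambda>n. (1 - s) * (of_nat (Suc n) * (1 - s) ^ n))" by (rule summable_mult)
  then have "summable (\<lambda>n. real (Suc n) * (1 - s) ^ Suc n)" by (simp add: mult_ac)
  then show ?thesis by (subst (asm) summable_Suc_iff)
qed

lemma summable_occupation: "summable (\<lambda>k. occupation k j)"
  using s_pos p_pos q_pos r_nonneg total occupation_nonneg occupation_le
  by (intro summable_comparison_test'[OF summable_geometric[of "1 - s"]]) auto

lemma summable_moment: "summable (\<lambda>k. real k * occupation k j)"
  using occupation_nonneg occupation_le
  by (intro summable_comparison_test'[OF summable_geometric_moment])
     (auto intro!: mult_left_mono)

text \<open>The expected number of visits to \<open>j\<close> of the walk started in 0 (its Green function),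
  and the same sum with each visit weighted by its time.\<close>

definition green :: "int \<Rightarrow> real" where "green j = (\<Sum>k. occupation k j)"
definition moment :: "int \<Rightarrow> real" where "moment j = (\<Sum>k. real k * occupation k j)"

lemma green_bounded: "\<bar>green j\<bar> \<le> (\<Sum>k. (1 - s) ^ k)"
proof -
  have "green j \<le> (\<Sum>k. (1 - s) ^ k)"
    unfolding green_def using s_pos p_pos q_pos r_nonneg total occupation_le summable_occupation
    by (intro suminf_le summable_geometric) auto
  moreover have "green j \<ge> 0"
    unfolding green_def using occupation_nonneg summable_occupation by (intro suminf_nonneg) auto
  ultimately show ?thesis by simp
qed

lemma moment_bounded: "\<bar>moment j\<bar> \<le> (\<Sum>k. real k * (1 - s) ^ k)"
proof -
  have "moment j \<le> (\<Sum>k. real k * (1 - s) ^ k)"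
    unfolding moment_def using occupation_le summable_moment summable_geometric_moment
    by (intro suminf_le) (auto intro!: mult_left_mono)
  moreover have "moment j \<ge> 0"
    unfolding moment_def using occupation_nonneg summable_moment by (intro suminf_nonneg) auto
  ultimately show ?thesis by simp
qed

lemma sums_evolve:
  assumes "\<And>j. summable (\<lambda>k. f k j)"
  shows "(\<lambda>k. evolve (f k) j) sums evolve (\<lambda>j. \<Sum>k. f k j) j"
  unfolding evolve_def using assms by (intro sums_add sums_mult summable_sums)

text \<open>The term for \<open>k = 0\<close> is the point mass at the origin; each later term evolves from its
  predecessor.\<close>

lemma green_eq: "green j = evolve green j + of_bool (j = 0)"
proof -
  have "(\<lambda>k. occupation (Suc k) j) sums evolve green j"
    using sums_evolve[of occupation j] summable_occupation by (simp add: green_def[abs_def])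
  then have "(\<lambda>k. occupation k j) sums (evolve green j + occupation 0 j)"
    by (rule sums_Suc)
  then show ?thesis by (simp add: green_def sums_iff)
qed

text \<open>Here the weight \<open>k + 1\<close> of the evolved term splits into \<open>k\<close>, which gives \<open>moment\<close> again, and 1,
  which gives the series of \<open>green\<close> without its first term.\<close>

lemma moment_eq: "moment j = evolve moment j + (green j - of_bool (j = 0))"
proof -
  have "(\<lambda>k. evolve (\<lambda>j. real k * occupation k j) j) sums evolve moment j"
    using sums_evolve[of "\<lambda>k j. real k * occupation k j" j] summable_moment by (simp add: moment_def[abs_def])
  moreover have "(\<lambda>k. evolve (occupation k) j) sums evolve green j"
    using sums_evolve[of occupation j] summable_occupation by (simp add: green_def[abs_def])
  ultimately have "(\<lambda>k. evolve (\<lambda>j. real k * occupation k j) j + evolve (occupation k) j) sums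
      (evolve moment j + evolve green j)"
    by (rule sums_add)
  then have "(\<lambda>k. real (Suc k) * occupation (Suc k) j) sums (evolve moment j + evolve green j)"
    by (simp add: evolve_def algebra_simps)
  then have "(\<lambda>k. real k * occupation k j) sums (evolve moment j + evolve green j + real 0 * occupation 0 j)"
    by (rule sums_Suc)
  then show ?thesis using green_eq[of j] by (simp add: moment_def sums_iff)
qed

lemma green_closed_form: "green j = two_sided \<zeta> 0 j"
proof (rule bounded_solution_unique[where c = "\<lambda>j. of_bool (j = 0)"])
  show "two_sided \<zeta> 0 j = evolve (two_sided \<zeta> 0) j + of_bool (j = 0)" for j
    using \<delta>_pos unfolding evolve_two_sided by (simp add: \<zeta>_eq two_sided_def)
qed (rule green_bounded green_eq)+

lemma moment_closed_form: "moment j = two_sided (\<zeta>^3 * (r * (1 - r) + 4 * p * q)) (\<zeta>^2) j"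
proof (rule bounded_solution_unique[where c = "\<lambda>j. green j - of_bool (j = 0)"])
  let ?a = "\<zeta>^3 * (r * (1 - r) + 4 * p * q)" and ?b = "\<zeta>^2"
  \<comment> \<open>The point source has strength 1 and the slope term reproduces \<open>green\<close>; these two
    conditions determine the coefficients.\<close>
  have "\<delta> * ?a - (1 - r) * ?b = ?b * (r * (1 - r) + 4 * p * q - (1 - r))"
    using \<delta>_pos by (simp add: \<zeta>_eq power2_eq_square power3_eq_cube field_simps)
  also have "r * (1 - r) + 4 * p * q - (1 - r) = - (\<delta>^2)"
    unfolding \<delta>_square by (simp add: power2_eq_square algebra_simps)
  also have "?b * (- (\<delta>^2)) = - 1"
    using \<delta>_pos by (simp add: \<zeta>_eq power_divide)
  finally have 1: "\<delta> * ?a - (1 - r) * ?b = - 1" .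
  have 2: "?b * \<delta> = \<zeta>"
    using \<delta>_pos by (simp add: \<zeta>_eq power2_eq_square)
  show "two_sided ?a ?b j = evolve (two_sided ?a ?b) j + (green j - of_bool (j = 0))" for j
    unfolding evolve_two_sided green_closed_form 1 2 by simp
qed (rule moment_bounded moment_eq)+

end

section \<open>Paths that make only possible transitions\<close>

text \<open>Such a path either survives forever or is absorbed exactly once, in the state where it was last
  alive, and then stays there.\<close>

lemma admissible_path_cases:
  fixes x :: "nat \<Rightarrow> state"
  assumes start: "x 0 = Alive i" and steps: "\<And>k. trans_prob p q r s (x k) (x (Suc k)) \<noteq> 0"
  obtains "\<And>k. x k \<in> range Alive"
  | K n where "\<And>l. l \<le> K \<Longrightarrow> x l \<in> range Alive" "x K = Alive n" "\<And>l. l > K \<Longrightarrow> x l = Absorbed n"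
proof (cases "\<forall>k. x k \<in> range Alive")
  case True
  then show ?thesis using that(1) by blast
next
  case False
  define L where "L = (LEAST k. x k \<notin> range Alive)"
  have L: "x L \<notin> range Alive" unfolding L_def using False by (metis (mono_tags, lifting) LeastI)
  have below: "x l \<in> range Alive" if "l < L" for l
    using not_less_Least that unfolding L_def by blast
  have "L \<noteq> 0" using L start by (metis rangeI)
  then obtain K where K: "L = Suc K" by (cases L) auto
  obtain n where n: "x K = Alive n" using below[of K] K by auto
  obtain m where "x (Suc K) = Absorbed m" using L K by (cases "x (Suc K)") auto
  then have absorbed: "x (Suc K) = Absorbed n"
    using steps[of K] n by (auto split: if_splits)
  have "x l = Absorbed n" if "l > K" for l
  proof -
    from that have "Suc K \<le> l" by simp
    then show ?thesis
    proof (induction l rule: dec_induct)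
      case base
      show ?case by (rule absorbed)
    next
      case (step l)
      then show ?case using steps[of l] by (auto split: if_splits)
    qed
  qed
  then show ?thesis using that(2) below K n by (metis less_Suc_eq_le)
qed

lemma absorption_time_eq:
  assumes "\<And>l. l \<le> K \<Longrightarrow> X l \<omega> \<in> range Alive" "\<And>l. l > K \<Longrightarrow> X l \<omega> = Absorbed n"
  shows "absorption_time X \<omega> = enat K"
proof -
  have "(LEAST k. \<exists>n. X (Suc k) \<omega> = Absorbed n) = K"
  proof (rule Least_equality)
    show "\<exists>n. X (Suc K) \<omega> = Absorbed n" using assms(2) by auto
    show "K \<le> k" if "\<exists>n. X (Suc k) \<omega> = Absorbed n" for k
      using assms(1)[of "Suc k"] that by (cases "Suc k \<le> K") auto
  qed
  moreover have "\<exists>k n. X (Suc k) \<omega> = Absorbed n" using assms(2) by auto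
  ultimately show ?thesis by (simp add: absorption_time_def)
qed

context
  fixes X :: "nat \<Rightarrow> 'a \<Rightarrow> state" and \<omega> :: 'a and i :: int and p q r s :: real
  assumes start: "X 0 \<omega> = Alive i"
    and steps: "\<And>k. trans_prob p q r s (X k \<omega>) (X (Suc k) \<omega>) \<noteq> 0"
begin

text \<open>The time before absorption counts the steps after which the particle is still alive. The identity
  includes paths that are never absorbed, where both sides are infinite.\<close>

lemma absorption_time_as_series:
  "ennreal_of_enat (absorption_time X \<omega>) = (\<Sum>k. indicator {\<omega>. X (Suc k) \<omega> \<in> range Alive} \<omega>)"
proof (rule admissible_path_cases[of "\<lambda>k. X k \<omega>", OF start steps])
  assume alive: "\<And>k. X k \<omega> \<in> range Alive"
  have "X (Suc k) \<omega> \<noteq> Absorbed n" for k n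
    using alive[of "Suc k"] by auto
  then have "absorption_time X \<omega> = \<infinity>"
    by (simp add: absorption_time_def)
  moreover have "(\<Sum>k. ennreal 1) = top"
    using summable_suminf_not_top[of "\<lambda>_. 1"] by (auto simp: summable_const_iff)
  ultimately show ?thesis using alive by simp
next
  fix K n
  assume K: "\<And>l. l \<le> K \<Longrightarrow> X l \<omega> \<in> range Alive" "\<And>l. l > K \<Longrightarrow> X l \<omega> = Absorbed n"
  have time: "absorption_time X \<omega> = enat K"
    using K by (rule absorption_time_eq)
  have "(\<Sum>k. indicator {\<omega>. X (Suc k) \<omega> \<in> range Alive} \<omega>) =
      (\<Sum>k<K. indicator {\<omega>. X (Suc k) \<omega> \<in> range Alive} \<omega> :: ennreal)"
  proof (rule suminf_finite)
    show "indicator {\<omega>. X (Suc k) \<omega> \<in> range Alive} \<omega> = (0 :: ennreal)" if "k \<notin> {..<K}" for k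
    proof -
      have "X (Suc k) \<omega> = Absorbed n" using that K(2)[of "Suc k"] by simp
      then show ?thesis by (auto simp: indicator_def)
    qed
  qed simp
  also have "\<dots> = (\<Sum>k<K. 1)"
    using K(1) by (intro sum.cong) auto
  also have "\<dots> = ennreal_of_enat (absorption_time X \<omega>)"
    unfolding time by simp
  finally show ?thesis by simp
qed

text \<open>At most one \<open>k\<close> contributes, the time at which the particle is last alive. A path that is
  never absorbed contributes 0 on both sides, since its infinite time is multiplied by 0.\<close>

lemma absorption_time_in_as_series:
  assumes "\<omega> \<in> space M"
  shows "ennreal_of_enat (absorption_time X \<omega>) * indicator (absorbed_in M X j) \<omega> =
    (\<Sum>k. of_nat k * indicator {\<omega>\<in>space M. X k \<omega> = Alive j \<and> X (Suc k) \<omega> = Absorbed j} \<omega>)"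
proof (rule admissible_path_cases[of "\<lambda>k. X k \<omega>", OF start steps])
  assume alive: "\<And>k. X k \<omega> \<in> range Alive"
  have "X k \<omega> \<noteq> Absorbed n" for k n
    using alive[of k] by auto
  then show ?thesis by (simp add: absorbed_in_def)
next
  fix K n
  assume K: "\<And>l. l \<le> K \<Longrightarrow> X l \<omega> \<in> range Alive" "\<And>l. l > K \<Longrightarrow> X l \<omega> = Absorbed n"
    and KA: "X K \<omega> = Alive n"
  have time: "absorption_time X \<omega> = enat K"
    using K by (rule absorption_time_eq)
  let ?f = "\<lambda>k. of_nat k * indicator {\<omega>\<in>space M. X k \<omega> = Alive j \<and> X (Suc k) \<omega> = Absorbed j} \<omega> :: ennreal"
  have "?f k = 0" if "k \<noteq> K" for k
  proof (cases "k < K")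
    case True
    then show ?thesis using K(1)[of "Suc k"] by auto
  next
    case False
    then show ?thesis using K(2)[of k] that by auto
  qed
  then have "(\<Sum>k. ?f k) = (\<Sum>k\<in>{K}. ?f k)"
    by (intro suminf_finite) auto
  also have "\<dots> = of_nat K * indicator {n} j"
    using K(2)[of "Suc K"] KA assms by (auto simp: indicator_def)
  also have "indicator {n} j = (indicator (absorbed_in M X j) \<omega> :: ennreal)"
  proof -
    have "(\<exists>k. X k \<omega> = Absorbed j) \<longleftrightarrow> n = j"
    proof
      assume "\<exists>k. X k \<omega> = Absorbed j"
      then obtain k where k: "X k \<omega> = Absorbed j" by blast
      then have "k > K" using K(1)[of k] by (cases "k \<le> K") auto
      then show "n = j" using K(2) k by simp
    next
      assume "n = j"
      then show "\<exists>k. X k \<omega> = Absorbed j" using K(2)[of "Suc K"] by auto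
    qed
    then show ?thesis using assms by (auto simp: absorbed_in_def indicator_def)
  qed
  finally show ?thesis unfolding time by simp
qed

end

section \<open>The random walk\<close>

locale pqrs_process = prob_space M + pqrs_parameters p q r s
  for M :: "'a measure" and X :: "nat \<Rightarrow> 'a \<Rightarrow> state" and i :: int and p q r s :: real +
  assumes X_measurable [measurable]: "X k \<in> measurable M (count_space UNIV)"
    and start: "prob {\<omega> \<in> space M. X 0 \<omega> = Alive i} = 1"
    and markov: "prob {\<omega> \<in> space M. (\<forall>l\<le>k. X l \<omega> = x l) \<and> X (Suc k) \<omega> = y} =
        prob {\<omega> \<in> space M. \<forall>l\<le>k. X l \<omega> = x l} * trans_prob p q r s (x k) y"
begin

lemma trans_prob_nonneg: "trans_prob p q r s x y \<ge> 0"
  using p_pos q_pos s_pos r_nonneg by (cases x; cases y) auto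

text \<open>The Markov property is given for complete histories. There are only countably many histories up to
  time \<open>k\<close>, so those that end in \<open>a\<close> can be summed up.\<close>

lemma one_step_markov:
  "emeasure M {\<omega> \<in> space M. X k \<omega> = a \<and> X (Suc k) \<omega> = b} =
   emeasure M {\<omega> \<in> space M. X k \<omega> = a} * ennreal (trans_prob p q r s a b)"
proof -
  define I where "I = {x \<in> PiE {..k} (\<lambda>_. UNIV :: state set). x k = a}"
  let ?C = "\<lambda>x. {\<omega> \<in> space M. \<forall>l\<le>k. X l \<omega> = x l}"
  let ?C' = "\<lambda>x. {\<omega> \<in> space M. (\<forall>l\<le>k. X l \<omega> = x l) \<and> X (Suc k) \<omega> = b}"
  have "countable (PiE {..k} (\<lambda>_. UNIV :: state set))"
    by (intro countable_PiE) auto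
  then have I: "countable I" unfolding I_def by (rule countable_subset[rotated]) auto
  have path: "restrict (\<lambda>l. X l \<omega>) {..k} \<in> I" if "X k \<omega> = a" for \<omega>
    using that by (simp add: I_def)
  have disj: "disjoint_family_on ?C I"
    unfolding disjoint_family_on_def
  proof (intro ballI impI)
    fix x y assume xy: "x \<in> I" "y \<in> I" "x \<noteq> y"
    have "\<exists>l\<le>k. x l \<noteq> y l"
    proof (rule ccontr)
      assume "\<not> (\<exists>l\<le>k. x l \<noteq> y l)"
      then have "x = y" using xy(1,2) unfolding I_def by (intro PiE_ext[of x "{..k}" _ y]) auto
      with xy(3) show False ..
    qed
    then show "?C x \<inter> ?C y = {}" by auto
  qed
  then have disj': "disjoint_family_on ?C' I"
    unfolding disjoint_family_on_def by blast
  have "{\<omega> \<in> space M. X k \<omega> = a \<and> X (Suc k) \<omega> = b} = (\<Union>x\<in>I. ?C' x)"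
    using path by (fastforce simp: I_def)
  then have "emeasure M {\<omega> \<in> space M. X k \<omega> = a \<and> X (Suc k) \<omega> = b} =
      (\<integral>\<^sup>+x. emeasure M (?C' x) \<partial>count_space I)"
    using I disj' by (simp only:) (intro emeasure_UN_countable; measurable)
  also have "\<dots> = (\<integral>\<^sup>+x. emeasure M (?C x) * ennreal (trans_prob p q r s a b) \<partial>count_space I)"
  proof (rule nn_integral_cong)
    fix x assume "x \<in> space (count_space I)"
    then have "x k = a" by (simp add: I_def)
    then show "emeasure M (?C' x) = emeasure M (?C x) * ennreal (trans_prob p q r s a b)"
      using markov[of k x b] trans_prob_nonneg by (simp add: emeasure_eq_measure ennreal_mult')
  qed
  also have "\<dots> = (\<integral>\<^sup>+x. emeasure M (?C x) \<partial>count_space I) * ennreal (trans_prob p q r s a b)"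
    by (intro nn_integral_multc) simp
  also have "(\<integral>\<^sup>+x. emeasure M (?C x) \<partial>count_space I) = emeasure M (\<Union>x\<in>I. ?C x)"
    using I disj by (intro emeasure_UN_countable[symmetric]; measurable)
  also have "(\<Union>x\<in>I. ?C x) = {\<omega> \<in> space M. X k \<omega> = a}"
    using path by (fastforce simp: I_def)
  finally show ?thesis .
qed

text \<open>The pairs of states are countable, so the impossible transitions at all times together form a
  null event.\<close>

lemma AE_admissible: "AE \<omega> in M. X 0 \<omega> = Alive i \<and> (\<forall>k. trans_prob p q r s (X k \<omega>) (X (Suc k) \<omega>) \<noteq> 0)"
proof -
  have "AE \<omega> in M. X 0 \<omega> = Alive i"
    using start by (subst prob_Collect_eq_1[symmetric]) simp_all
  moreover have "AE \<omega> in M. trans_prob p q r s (X k \<omega>) (X (Suc k) \<omega>) \<noteq> 0" for k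
  proof -
    have "AE \<omega> in M. trans_prob p q r s a b = 0 \<longrightarrow> \<not> (X k \<omega> = a \<and> X (Suc k) \<omega> = b)" for a b
    proof (cases "trans_prob p q r s a b = 0")
      case True
      then have "emeasure M {\<omega> \<in> space M. X k \<omega> = a \<and> X (Suc k) \<omega> = b} = 0"
        by (simp add: one_step_markov)
      then show ?thesis by (intro AE_I[where N = "{\<omega> \<in> space M. X k \<omega> = a \<and> X (Suc k) \<omega> = b}"]) auto
    qed simp
    then have "AE \<omega> in M. \<forall>a b. trans_prob p q r s a b = 0 \<longrightarrow> \<not> (X k \<omega> = a \<and> X (Suc k) \<omega> = b)"
      unfolding AE_all_countable by blast
    then show ?thesis by eventually_elim blast
  qed
  ultimately show ?thesis by (simp add: AE_all_countable)
qed

text \<open>A particle that is alive at time \<open>k\<close> is almost surely either alive at time \<open>k + 1\<close> or absorbed in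
  between, and the
  latter has probability \<open>s\<close> wherever the particle is.\<close>

lemma prob_alive: "emeasure M {\<omega> \<in> space M. X k \<omega> \<in> range Alive} = ennreal ((1 - s) ^ k)"
proof (induction k)
  case 0
  have "emeasure M {\<omega> \<in> space M. X 0 \<omega> \<in> range Alive} = 1"
    using AE_admissible by (intro emeasure_eq_1_AE) auto
  then show ?case by simp
next
  case (Suc k)
  let ?A = "\<lambda>k. {\<omega> \<in> space M. X k \<omega> \<in> range Alive}"
  let ?absorb = "\<lambda>n. {\<omega> \<in> space M. X k \<omega> = Alive n \<and> X (Suc k) \<omega> = Absorbed n}"
  have "emeasure M (\<Union>n. ?absorb n) = (\<integral>\<^sup>+n. emeasure M (?absorb n) \<partial>count_space UNIV)"
    by (rule emeasure_UN_countable) (auto simp: disjoint_family_on_def)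
  also have "\<dots> = (\<integral>\<^sup>+n. emeasure M {\<omega> \<in> space M. X k \<omega> = Alive n} * ennreal s \<partial>count_space UNIV)"
    unfolding one_step_markov by simp
  also have "\<dots> = (\<integral>\<^sup>+n. emeasure M {\<omega> \<in> space M. X k \<omega> = Alive n} \<partial>count_space UNIV) * ennreal s"
    by (rule nn_integral_multc) simp
  also have "(\<integral>\<^sup>+n. emeasure M {\<omega> \<in> space M. X k \<omega> = Alive n} \<partial>count_space UNIV) =
      emeasure M (\<Union>n. {\<omega> \<in> space M. X k \<omega> = Alive n})"
    by (rule emeasure_UN_countable[symmetric]) (auto simp: disjoint_family_on_def)
  also have "(\<Union>n. {\<omega> \<in> space M. X k \<omega> = Alive n}) = ?A k"
    by auto
  finally have absorb: "emeasure M (\<Union>n. ?absorb n) = ennreal ((1 - s) ^ k * s)"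
    using Suc s_pos by (simp add: ennreal_mult'')
  have "emeasure M (?A k) = emeasure M (?A (Suc k) \<union> (\<Union>n. ?absorb n))"
  proof (rule emeasure_eq_AE)
    show "AE \<omega> in M. \<omega> \<in> ?A k \<longleftrightarrow> \<omega> \<in> ?A (Suc k) \<union> (\<Union>n. ?absorb n)"
      using AE_admissible
    proof eventually_elim
      case (elim \<omega>)
      then have "trans_prob p q r s (X k \<omega>) (X (Suc k) \<omega>) \<noteq> 0" by blast
      then show ?case by (cases "X k \<omega>"; cases "X (Suc k) \<omega>") (auto split: if_splits)
    qed
  qed measurable
  also have "\<dots> = emeasure M (?A (Suc k)) + emeasure M (\<Union>n. ?absorb n)"
    by (rule plus_emeasure[symmetric]) auto
  finally have "ennreal ((1 - s) ^ k) = ennreal (measure M (?A (Suc k)) + (1 - s) ^ k * s)"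
    unfolding Suc absorb emeasure_eq_measure[of "?A (Suc k)"]
    using s_pos p_pos q_pos r_nonneg total by (subst ennreal_plus) auto
  then have "(1 - s) ^ k = measure M (?A (Suc k)) + (1 - s) ^ k * s"
    using s_pos p_pos q_pos r_nonneg total by (subst (asm) ennreal_inj) auto
  then have "measure M (?A (Suc k)) = (1 - s) ^ Suc k"
    by (simp add: algebra_simps)
  then show ?case by (simp only: emeasure_eq_measure)
qed

lemma expected_time_eq: "expected_time M X = ennreal ((1 - s) / s)"
proof -
  have "expected_time M X =
      (\<integral>\<^sup>+ \<omega>. (\<Sum>k. indicator {\<omega> \<in> space M. X (Suc k) \<omega> \<in> range Alive} \<omega>) \<partial>M)"
    unfolding expected_time_def
  proof (rule nn_integral_cong_AE)
    show "AE \<omega> in M. ennreal_of_enat (absorption_time X \<omega>) =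
        (\<Sum>k. indicator {\<omega> \<in> space M. X (Suc k) \<omega> \<in> range Alive} \<omega>)"
      using AE_admissible AE_space
    proof eventually_elim
      case (elim \<omega>)
      then show ?case
        using absorption_time_as_series[of X \<omega> i p q r s] by (simp add: indicator_def)
    qed
  qed
  also have "\<dots> = (\<Sum>k. \<integral>\<^sup>+ \<omega>. indicator {\<omega> \<in> space M. X (Suc k) \<omega> \<in> range Alive} \<omega> \<partial>M)"
    by (rule nn_integral_suminf) measurable
  also have "\<dots> = (\<Sum>k. ennreal ((1 - s) ^ Suc k))"
    by (simp add: prob_alive[symmetric] del: power_Suc)
  also have "\<dots> = ennreal ((1 - s) / s)"
  proof (rule suminf_ennreal_eq)
    show "0 \<le> (1 - s) ^ Suc k" for k
      using s_pos p_pos q_pos r_nonneg total by simp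
    have "(\<lambda>k. (1 - s) * (1 - s) ^ k) sums ((1 - s) * (1 / (1 - (1 - s))))"
      using s_pos p_pos q_pos r_nonneg total by (intro sums_mult geometric_sums) simp
    then show "(\<lambda>k. (1 - s) ^ Suc k) sums ((1 - s) / s)" by simp
  qed
  finally show ?thesis .
qed

lemma expected_time_in_eq:
  "expected_time_in M X j = (\<Sum>k. ennreal (s * (real k * k_step_prob M X j k)))"
proof -
  let ?E = "\<lambda>k. {\<omega> \<in> space M. X k \<omega> = Alive j \<and> X (Suc k) \<omega> = Absorbed j}"
  have "expected_time_in M X j = (\<integral>\<^sup>+ \<omega>. (\<Sum>k. of_nat k * indicator (?E k) \<omega>) \<partial>M)"
    unfolding expected_time_in_def
  proof (rule nn_integral_cong_AE)
    show "AE \<omega> in M. ennreal_of_enat (absorption_time X \<omega>) * indicator (absorbed_in M X j) \<omega> =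
        (\<Sum>k. of_nat k * indicator (?E k) \<omega>)"
      using AE_admissible AE_space
    proof eventually_elim
      case (elim \<omega>)
      then show ?case
        using absorption_time_in_as_series[of X \<omega> i p q r s M j] by blast
    qed
  qed
  also have "\<dots> = (\<Sum>k. \<integral>\<^sup>+ \<omega>. of_nat k * indicator (?E k) \<omega> \<partial>M)"
    by (rule nn_integral_suminf) measurable
  also have "\<dots> = (\<Sum>k. of_nat k * emeasure M (?E k))"
    by (intro suminf_cong nn_integral_cmult_indicator) measurable
  also have "\<dots> = (\<Sum>k. ennreal (s * (real k * k_step_prob M X j k)))"
    unfolding one_step_markov using s_pos
    by (simp add: k_step_prob_def emeasure_eq_measure ennreal_mult'' ennreal_of_nat_eq_real_of_nat mult_ac)
  finally show ?thesis .
qed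

lemma k_step_prob_0: "k_step_prob M X j 0 = of_bool (j = i)"
proof (cases "j = i")
  case True
  then show ?thesis using start by (simp add: k_step_prob_def)
next
  case False
  then have "prob {\<omega> \<in> space M. X 0 \<omega> = Alive j} = 0"
    using AE_admissible by (subst prob_Collect_eq_0) auto
  then show ?thesis using False by (simp add: k_step_prob_def)
qed

lemma k_step_prob_Suc:
  "k_step_prob M X j (Suc k) =
    p * k_step_prob M X (j - 1) k + q * k_step_prob M X (j + 1) k + r * k_step_prob M X j k"
proof -
  let ?E = "\<lambda>n. {\<omega> \<in> space M. X k \<omega> = Alive n \<and> X (Suc k) \<omega> = Alive j}"
  have E: "prob (?E n) = k_step_prob M X n k * trans_prob p q r s (Alive n) (Alive j)" for n
    using one_step_markov[of k "Alive n" "Alive j"] trans_prob_nonneg[of "Alive n" "Alive j"]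
    unfolding k_step_prob_def emeasure_eq_measure
    by (simp add: ennreal_mult''[symmetric] del: trans_prob.simps)
  have "k_step_prob M X j (Suc k) = prob (\<Union>n\<in>{j - 1, j, j + 1}. ?E n)"
    unfolding k_step_prob_def
  proof (rule measure_eq_AE)
    show "AE \<omega> in M. \<omega> \<in> {\<omega> \<in> space M. X (Suc k) \<omega> = Alive j} \<longleftrightarrow>
        \<omega> \<in> (\<Union>n\<in>{j - 1, j, j + 1}. ?E n)"
      using AE_admissible
    proof eventually_elim
      case (elim \<omega>)
      then have "trans_prob p q r s (X k \<omega>) (X (Suc k) \<omega>) \<noteq> 0" by blast
      then show ?case by (cases "X k \<omega>") (auto split: if_splits)
    qed
  qed measurable
  also have "\<dots> = (\<Sum>n\<in>{j - 1, j, j + 1}. prob (?E n))"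
    by (rule finite_measure_finite_Union) (auto simp: disjoint_family_on_def)
  also have "\<dots> = p * k_step_prob M X (j - 1) k + q * k_step_prob M X (j + 1) k + r * k_step_prob M X j k"
    unfolding E by simp
  finally show ?thesis .
qed

text \<open>The transition probabilities are translation invariant, so the walk from \<open>i\<close> is a shift of the
  walk from 0.\<close>

lemma k_step_prob_eq_occupation: "k_step_prob M X j k = occupation k (j - i)"
proof (induction k arbitrary: j)
  case 0
  then show ?case by (simp add: k_step_prob_0)
next
  case (Suc k)
  then show ?case by (simp add: k_step_prob_Suc evolve_def algebra_simps)
qed

lemma summable_k_step_moment: "summable (\<lambda>k. real k * k_step_prob M X j k)"
  unfolding k_step_prob_eq_occupation by (rule summable_moment)

lemma expected_time_in_eq_moment:
  "expected_time_in M X j = ennreal (s * (\<Sum>k. real k * k_step_prob M X j k))"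
proof -
  have "(\<Sum>k. ennreal (s * (real k * k_step_prob M X j k))) =
      ennreal (\<Sum>k. s * (real k * k_step_prob M X j k))"
    using s_pos summable_mult[OF summable_k_step_moment, of s]
    by (intro suminf_ennreal2) (simp_all add: k_step_prob_def)
  also have "(\<Sum>k. s * (real k * k_step_prob M X j k)) = s * (\<Sum>k. real k * k_step_prob M X j k)"
    by (rule suminf_mult[OF summable_k_step_moment])
  finally show ?thesis unfolding expected_time_in_eq .
qed

end

lemma pqrs_walk_imp_process:
  assumes "p > 0" "q > 0" "s > 0" "r \<ge> 0" "p + q + r + s = 1" and "pqrs_walk p q r s i M X"
  shows "pqrs_process M X i p q r s"
  using assms
  by (auto simp: pqrs_walk_def pqrs_process_def pqrs_process_axioms_def pqrs_parameters_def)

theorem theorem9: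
  fixes p q r s :: real
  assumes "p > 0" and "q > 0" and "s > 0" and "r \<ge> 0" and "p + q + r + s = 1"
  shows
    "(\<forall>(M :: 'a measure) X i. pqrs_walk p q r s i M X \<longrightarrow>
        expected_time M X = ennreal ((1 - s) / s)) \<and>
     (\<forall>(M :: 'a measure) X j. pqrs_walk p q r s 0 M X \<longrightarrow>
        summable (\<lambda>k. real k * k_step_prob M X j k) \<and>
        expected_time_in M X j = ennreal (s * (\<Sum>k. real k * k_step_prob M X j k)) \<and>
        (j \<le> 0 \<longrightarrow> s * (\<Sum>k. real k * k_step_prob M X j k) =
           s * (zeta1 p q r)^2 * xi1 p q r powi j *
             (zeta1 p q r * (r * (1 - r) + 4 * p * q) - of_int j)) \<and>
        (j \<ge> 0 \<longrightarrow> s * (\<Sum>k. real k * k_step_prob M X j k) =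
           s * (zeta1 p q r)^2 * xi2 p q r powi j *
             (zeta1 p q r * (r * (1 - r) + 4 * p * q) + of_int j)))"
proof (intro conjI allI impI)
  fix M :: "'a measure" and X i
  assume "pqrs_walk p q r s i M X"
  then interpret pqrs_process M X i p q r s
    using assms by (intro pqrs_walk_imp_process)
  show "expected_time M X = ennreal ((1 - s) / s)"
    by (rule expected_time_eq)
next
  fix M :: "'a measure" and X j
  assume "pqrs_walk p q r s 0 M X"
  then interpret pqrs_process M X 0 p q r s
    using assms by (intro pqrs_walk_imp_process)
  show "summable (\<lambda>k. real k * k_step_prob M X j k)"
    by (rule summable_k_step_moment)
  show "expected_time_in M X j = ennreal (s * (\<Sum>k. real k * k_step_prob M X j k))"
    by (rule expected_time_in_eq_moment)
  have closed: "(\<Sum>k. real k * k_step_prob M X j k) =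
      two_sided (\<zeta>^3 * (r * (1 - r) + 4 * p * q)) (\<zeta>^2) j"
    using moment_closed_form[of j] by (simp add: moment_def k_step_prob_eq_occupation)
  show "s * (\<Sum>k. real k * k_step_prob M X j k) =
      s * \<zeta>^2 * \<xi>\<^sub>1 powi j * (\<zeta> * (r * (1 - r) + 4 * p * q) - of_int j)" if "j \<le> 0"
    unfolding closed two_sided_def using that
    by (simp add: power2_eq_square power3_eq_cube algebra_simps)
  show "s * (\<Sum>k. real k * k_step_prob M X j k) =
      s * \<zeta>^2 * \<xi>\<^sub>2 powi j * (\<zeta> * (r * (1 - r) + 4 * p * q) + of_int j)" if "j \<ge> 0"
    unfolding closed two_sided_nonneg[OF that]
    by (simp add: power2_eq_square power3_eq_cube algebra_simps)
qed

end
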